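(* Let $H$ and $G$ be finite graphs with $H\le G$ in $\mathcal{G}$ and $|G|-|H|>2$. Then the interval $[H,G]$ of $\mathcal{G}$ is disconnected if and only if it is strongly zero-split.
   Context: $\mathcal{G}$ is the poset of all finite unlabelled graphs (loops and multiple edges allowed), taken up to isomorphism, with $H\le G$ if and only if $H$ is isomorphic to an induced subgraph of $G$; $|G|$ denotes the number of vertices of $G$. For $x\le y$ the interval is $[x,y]=\{z: x\le z\le y\}$ and its interior is $(x,y)=[x,y]\setminus\{x,y\}$. The interval $[x,y]$ is disconnected if $(x,y)$ can be partitioned into two non-empty sets $A,B$ such that no element of $A$ is comparable to any element of $B$. Occurrences: label the vertices of $G$ arbitrarily by $[|G|]=\{1,\dots,|G|\}$; for $\eta\subseteq[|G|]$ let $G[\eta]$ be the induced subgraph on $\eta$; $\eta$ is an occurrence of $H$ in $G$ if $G[\eta]\cong H$, and $E(H,G)$ is the set of all occurrences of $H$ in $G$. For $\eta\in E(H,G)$ put $Z(\eta)=[|G|]\setminus\eta$, and for $A\subseteq E(H,G)$ put $Z(A)=\bigcup_{\eta\in A}Z(\eta)$. The interval $[H,G]$ is zero-split if $E(H,G)$ can be partitioned into two non-empty disjoint sets $A,B$ with $Z(A)\cap Z(B)=\emptyset$ (a zero-split partition). It is strongly zero-split if there is a zero-split partition $A,B$ such that there do not exist $\eta\in A$, $\phi\in B$, $i\in[|G|]\setminus\eta$ and $j\in[|G|]\setminus\phi$ with $G[\eta\cup\{i\}]\cong G[\phi\cup\{j\}]$. *)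

theory Defs
  imports "HOL-Library.Multiset" "HOL-Library.Uprod"
begin

text \<open>
  Edges form a multiset of unordered pairs: a loop at \<open>v\<close> is \<open>Upair v v\<close>, and parallel edges
  (or parallel loops) are repeated elements. Taking \<^typ>\<open>nat\<close> as vertex type loses no
  isomorphism class of finite graphs.
\<close>

typedef graph =
  "{(V :: nat set, E :: nat uprod multiset). finite V \<and> (\<forall>e \<in># E. set_uprod e \<subseteq> V)}"
proof
  show "({}, {#}) \<in> {(V :: nat set, E :: nat uprod multiset). finite V \<and> (\<forall>e \<in># E. set_uprod e \<subseteq> V)}"
    by simp
qed

setup_lifting type_definition_graph
lifting_forget uprod.lifting

lift_definition verts :: "graph \<Rightarrow> nat set" is fst .

lift_definition edges :: "graph \<Rightarrow> nat uprod multiset" is snd .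

lift_definition induced :: "graph \<Rightarrow> nat set \<Rightarrow> graph"
  is "\<lambda>(V, E) S. (V \<inter> S, filter_mset (\<lambda>e. set_uprod e \<subseteq> S) E)"
  by auto

definition isomorphic :: "graph \<Rightarrow> graph \<Rightarrow> bool" (infix "\<cong>\<^sub>G" 50) where
  "G \<cong>\<^sub>G H \<longleftrightarrow>
     (\<exists>f. bij_betw f (verts G) (verts H) \<and> edges H = image_mset (map_uprod f) (edges G))"

lemma finite_verts [simp]: "finite (verts G)"
  by transfer (simp add: split_beta)

lemma edges_verts: "e \<in># edges G \<Longrightarrow> set_uprod e \<subseteq> verts G"
  by transfer (simp add: split_beta)

lemma graph_eqI: "verts G = verts H \<Longrightarrow> edges G = edges H \<Longrightarrow> G = H"
  by transfer (simp add: prod_eq_iff)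

lemma verts_induced [simp]: "verts (induced G S) = verts G \<inter> S"
  by transfer (simp add: split_beta)

lemma edges_induced [simp]:
  "edges (induced G S) = filter_mset (\<lambda>e. set_uprod e \<subseteq> S) (edges G)"
  by transfer (simp add: split_beta)

lemma induced_verts [simp]: "induced G (verts G) = G"
proof (rule graph_eqI)
  have "filter_mset (\<lambda>e. set_uprod e \<subseteq> verts G) (edges G) = filter_mset (\<lambda>_. True) (edges G)"
    by (rule filter_mset_cong) (auto dest: edges_verts)
  then show "edges (induced G (verts G)) = edges G" by simp
qed simp

lemma induced_induced [simp]: "induced (induced G S) T = induced G (S \<inter> T)"
proof (rule graph_eqI)
  show "edges (induced (induced G S) T) = edges (induced G (S \<inter> T))"
    by (simp add: filter_filter_mset conj_commute)
qed auto

lemma isomorphic_refl [simp]: "G \<cong>\<^sub>G G"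
  unfolding isomorphic_def by (rule exI[of _ id]) (simp add: uprod.map_id0)

lemma isomorphic_sym: "G \<cong>\<^sub>G H \<Longrightarrow> H \<cong>\<^sub>G G"
proof -
  assume "G \<cong>\<^sub>G H"
  then obtain f where f: "bij_betw f (verts G) (verts H)"
    and E: "edges H = image_mset (map_uprod f) (edges G)"
    unfolding isomorphic_def by blast
  let ?g = "inv_into (verts G) f"
  have inj: "inj_on f (verts G)" using f by (rule bij_betw_imp_inj_on)
  have "image_mset (map_uprod ?g) (edges H) = image_mset (\<lambda>e. map_uprod (?g \<circ> f) e) (edges G)"
    unfolding E by (simp add: multiset.map_comp comp_def uprod.map_comp)
  also have "\<dots> = image_mset (\<lambda>e. e) (edges G)"
  proof (rule image_mset_cong)
    fix e assume "e \<in># edges G"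
    then have "set_uprod e \<subseteq> verts G" by (rule edges_verts)
    then have "map_uprod (?g \<circ> f) e = map_uprod id e"
      using inj by (intro uprod.map_cong0) auto
    then show "map_uprod (?g \<circ> f) e = e" by (simp add: uprod.map_id)
  qed
  finally have "edges G = image_mset (map_uprod ?g) (edges H)" by simp
  with bij_betw_inv_into[OF f] show ?thesis unfolding isomorphic_def by blast
qed

lemma isomorphic_trans: "G \<cong>\<^sub>G H \<Longrightarrow> H \<cong>\<^sub>G K \<Longrightarrow> G \<cong>\<^sub>G K"
proof -
  assume "G \<cong>\<^sub>G H" "H \<cong>\<^sub>G K"
  then obtain f g where f: "bij_betw f (verts G) (verts H)"
    and g: "bij_betw g (verts H) (verts K)"
    and E: "edges H = image_mset (map_uprod f) (edges G)"
      "edges K = image_mset (map_uprod g) (edges H)"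
    unfolding isomorphic_def by blast
  have "edges K = image_mset (map_uprod (g \<circ> f)) (edges G)"
    unfolding E by (simp add: multiset.map_comp comp_def uprod.map_comp)
  with bij_betw_trans[OF f g] show ?thesis unfolding isomorphic_def by blast
qed

lemma equivp_isomorphic: "equivp (\<cong>\<^sub>G)"
proof (rule equivpI)
  show "reflp (\<cong>\<^sub>G)" by (rule reflpI) simp
  show "symp (\<cong>\<^sub>G)" by (rule sympI) (rule isomorphic_sym)
  show "transp (\<cong>\<^sub>G)" by (rule transpI) (rule isomorphic_trans)
qed

lemma isomorphic_card: "G \<cong>\<^sub>G H \<Longrightarrow> card (verts G) = card (verts H)"
  unfolding isomorphic_def by (auto dest: bij_betw_same_card)

lemma isomorphic_induced:
  assumes "G \<cong>\<^sub>G H" "S \<subseteq> verts G"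
  shows "\<exists>T \<subseteq> verts H. induced G S \<cong>\<^sub>G induced H T"
proof -
  from assms(1) obtain f where f: "bij_betw f (verts G) (verts H)"
    and E: "edges H = image_mset (map_uprod f) (edges G)"
    unfolding isomorphic_def by blast
  have inj: "inj_on f (verts G)" and im: "f ` verts G = verts H"
    using f by (auto simp: bij_betw_def)
  have T: "f ` S \<subseteq> verts H" using assms(2) im by blast
  have "set_uprod (map_uprod f e) \<subseteq> f ` S \<longleftrightarrow> set_uprod e \<subseteq> S" if "e \<in># edges G" for e
    using edges_verts[OF that] assms(2) inj_on_image_mem_iff[OF inj _ assms(2)]
    unfolding uprod.set_map by blast
  then have "filter_mset (\<lambda>e. set_uprod e \<subseteq> f ` S) (edges H) =
      image_mset (map_uprod f) (filter_mset (\<lambda>e. set_uprod e \<subseteq> S) (edges G))"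
    unfolding E filter_mset_image_mset
    by (intro arg_cong[where f = "image_mset (map_uprod f)"] filter_mset_cong) auto
  moreover have "bij_betw f (verts G \<inter> S) (verts H \<inter> f ` S)"
    using inj T assms(2) by (auto simp: bij_betw_def inf.absorb2 intro: inj_on_subset)
  ultimately have "induced G S \<cong>\<^sub>G induced H (f ` S)"
    unfolding isomorphic_def by (intro exI[of _ f]) simp
  with T show ?thesis by blast
qed

quotient_type ugraph = graph / "(\<cong>\<^sub>G)"
  morphisms rep_ugraph unlabel
  by (rule equivp_isomorphic)

lift_definition usize :: "ugraph \<Rightarrow> nat" is "\<lambda>G. card (verts G)"
  by (rule isomorphic_card)

instantiation ugraph :: order
begin

lift_definition less_eq_ugraph :: "ugraph \<Rightarrow> ugraph \<Rightarrow> bool"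
  is "\<lambda>H G. \<exists>S \<subseteq> verts G. induced G S \<cong>\<^sub>G H"
proof -
  have *: "\<exists>S \<subseteq> verts G'. induced G' S \<cong>\<^sub>G H'"
    if iso: "H \<cong>\<^sub>G H'" "G \<cong>\<^sub>G G'" and ex: "\<exists>S \<subseteq> verts G. induced G S \<cong>\<^sub>G H" for H H' G G'
  proof -
    from ex obtain S where S: "S \<subseteq> verts G" "induced G S \<cong>\<^sub>G H" by blast
    obtain T where "T \<subseteq> verts G'" and T: "induced G S \<cong>\<^sub>G induced G' T"
      using isomorphic_induced[OF iso(2) S(1)] by blast
    moreover have "induced G' T \<cong>\<^sub>G H'"
      using isomorphic_trans[OF isomorphic_trans[OF isomorphic_sym[OF T] S(2)] iso(1)] .
    ultimately show ?thesis by blast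
  qed
  show "(\<exists>S \<subseteq> verts G. induced G S \<cong>\<^sub>G H) \<longleftrightarrow> (\<exists>S \<subseteq> verts G'. induced G' S \<cong>\<^sub>G H')"
    if "H \<cong>\<^sub>G H'" "G \<cong>\<^sub>G G'" for H H' G G'
    using *[OF that] *[OF that[THEN isomorphic_sym]] by blast
qed

definition less_ugraph :: "ugraph \<Rightarrow> ugraph \<Rightarrow> bool" where
  "less_ugraph H G \<longleftrightarrow> H \<le> G \<and> \<not> G \<le> H"

instance
proof
  show "x < y \<longleftrightarrow> x \<le> y \<and> \<not> y \<le> x" for x y :: ugraph
    by (rule less_ugraph_def)
  show "x \<le> x" for x :: ugraph
  proof transfer
    show "\<exists>S \<subseteq> verts G. induced G S \<cong>\<^sub>G G" for G
      by (intro exI[of _ "verts G"]) simp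
  qed
  show "x \<le> z" if "x \<le> y" "y \<le> z" for x y z :: ugraph
    using that
  proof transfer
    fix H G K
    assume "\<exists>S \<subseteq> verts G. induced G S \<cong>\<^sub>G H" "\<exists>S \<subseteq> verts K. induced K S \<cong>\<^sub>G G"
    then obtain S T where S: "S \<subseteq> verts G" "induced G S \<cong>\<^sub>G H"
      and T: "T \<subseteq> verts K" "induced K T \<cong>\<^sub>G G" by blast
    obtain R where "R \<subseteq> verts (induced K T)" "induced G S \<cong>\<^sub>G induced (induced K T) R"
      using isomorphic_induced[OF isomorphic_sym[OF T(2)] S(1)] by blast
    then have "T \<inter> R \<subseteq> verts K" "induced K (T \<inter> R) \<cong>\<^sub>G H"
      using T(1) isomorphic_trans[OF isomorphic_sym S(2)] by auto
    then show "\<exists>S \<subseteq> verts K. induced K S \<cong>\<^sub>G H" by blast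
  qed
  show "x = y" if "x \<le> y" "y \<le> x" for x y :: ugraph
    using that
  proof transfer
    fix H G
    assume "\<exists>S \<subseteq> verts G. induced G S \<cong>\<^sub>G H" "\<exists>S \<subseteq> verts H. induced H S \<cong>\<^sub>G G"
    then obtain S T where S: "S \<subseteq> verts G" "induced G S \<cong>\<^sub>G H"
      and T: "T \<subseteq> verts H" "induced H T \<cong>\<^sub>G G" by blast
    have "card S = card (verts H)" "card T = card (verts G)"
      using isomorphic_card[OF S(2)] isomorphic_card[OF T(2)] S(1) T(1)
      by (auto simp: inf.absorb2)
    moreover have "card T \<le> card (verts H)" using T(1) by (simp add: card_mono)
    ultimately have "S = verts G" using S(1) by (intro card_seteq) auto
    then show "H \<cong>\<^sub>G G" using S(2) by (simp add: isomorphic_sym)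
  qed
qed

end

definition disconnected_interval :: "'a :: order \<Rightarrow> 'a \<Rightarrow> bool" where
  "disconnected_interval x y \<longleftrightarrow>
     (\<exists>A B. A \<noteq> {} \<and> B \<noteq> {} \<and> A \<inter> B = {} \<and> A \<union> B = {x..y} - {x, y} \<and>
        (\<forall>a \<in> A. \<forall>b \<in> B. \<not> a \<le> b \<and> \<not> b \<le> a))"

text \<open>
  The vertices of an unlabelled graph have no names, so the notions about occurrences below take
  a labelling \<open>L\<close> of the upper end of the interval instead of that unlabelled graph itself.
\<close>

definition labelling :: "graph \<Rightarrow> ugraph \<Rightarrow> bool" where
  "labelling L G \<longleftrightarrow> unlabel L = G \<and> verts L = {1..usize G}"

lemma ex_labelling: "\<exists>L. labelling L G"
proof -
  have "\<exists>L. K \<cong>\<^sub>G L \<and> verts L = {1..card (verts K)}" for K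
  proof -
    obtain f where f: "bij_betw f (verts K) {1..card (verts K)}"
      using finite_same_card_bij[of "verts K" "{1..card (verts K)}"] by auto
    define L where
      "L = Abs_graph ({1..card (verts K)}, image_mset (map_uprod f) (edges K))"
    have "\<forall>e \<in># image_mset (map_uprod f) (edges K). set_uprod e \<subseteq> {1..card (verts K)}"
      using edges_verts[of _ K] f by (fastforce simp: uprod.set_map bij_betw_def)
    then have "Rep_graph L = ({1..card (verts K)}, image_mset (map_uprod f) (edges K))"
      unfolding L_def by (subst Abs_graph_inverse) auto
    then have "verts L = {1..card (verts K)}" "edges L = image_mset (map_uprod f) (edges K)"
      by (simp_all add: verts.rep_eq edges.rep_eq)
    with f have "K \<cong>\<^sub>G L \<and> verts L = {1..card (verts K)}"
      unfolding isomorphic_def by auto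
    then show ?thesis ..
  qed
  then have "\<exists>L. L \<cong>\<^sub>G K \<and> verts L = {1..card (verts K)}" for K
    using isomorphic_sym by blast
  moreover obtain K where "G = unlabel K"
    by (induction G rule: ugraph.abs_induct) blast
  ultimately show ?thesis
    unfolding labelling_def by (simp add: ugraph.abs_eq_iff usize.abs_eq)
qed

definition occurrences :: "ugraph \<Rightarrow> graph \<Rightarrow> nat set set" where
  "occurrences H L = {\<eta>. \<eta> \<subseteq> verts L \<and> unlabel (induced L \<eta>) = H}"

definition zeros :: "graph \<Rightarrow> nat set \<Rightarrow> nat set" where
  "zeros L \<eta> = verts L - \<eta>"

definition zero_split_partition ::
    "ugraph \<Rightarrow> graph \<Rightarrow> nat set set \<Rightarrow> nat set set \<Rightarrow> bool" where
  "zero_split_partition H L A B \<longleftrightarrow>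
     A \<noteq> {} \<and> B \<noteq> {} \<and> A \<inter> B = {} \<and> A \<union> B = occurrences H L \<and>
     (\<Union>\<eta> \<in> A. zeros L \<eta>) \<inter> (\<Union>\<phi> \<in> B. zeros L \<phi>) = {}"

definition strongly_zero_split :: "ugraph \<Rightarrow> graph \<Rightarrow> bool" where
  "strongly_zero_split H L \<longleftrightarrow>
     (\<exists>A B. zero_split_partition H L A B \<and>
        \<not> (\<exists>\<eta> \<in> A. \<exists>\<phi> \<in> B. \<exists>i \<in> verts L - \<eta>. \<exists>j \<in> verts L - \<phi>.
              induced L (\<eta> \<union> {i}) \<cong>\<^sub>G induced L (\<phi> \<union> {j})))"

end

theory Submission
  imports Defs
begin

text \<open>
  Every element of the interior is \<open>G[S]\<close> for some \<open>S\<close> strictly between an occurrence \<open>\<eta>\<close> of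
  \<open>H\<close> and the whole vertex set \<open>V\<close>. As \<open>|V - \<eta>| > 2\<close>, any two such sets \<open>S\<close>, \<open>S'\<close> over the same
  \<open>\<eta>\<close> are linked by \<open>\<eta> \<union> {i}\<close>, \<open>\<eta> \<union> {i, j}\<close>, \<open>\<eta> \<union> {j}\<close>, so a disconnection of the interval
  induces a partition of the occurrences; a common zero \<open>v\<close> of two occurrences on different sides
  would put \<open>G[V - {v}]\<close> on both sides.
  Conversely, let \<open>G[S] \<le> G[T]\<close> with \<open>S\<close> above \<open>\<eta> \<in> A\<close> and \<open>T\<close> above \<open>\<phi> \<in> B\<close>. Then \<open>T\<close> contains
  a copy \<open>\<eta>' \<union> {j}\<close> of some \<open>\<eta> \<union> {i}\<close>. Strongness excludes \<open>\<eta>' \<in> B\<close>, and if \<open>\<eta>' \<in> A\<close> then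
  every vertex outside \<open>T\<close> is a common zero of \<open>\<eta>'\<close> and \<open>\<phi>\<close>.
\<close>

lemma le_unlabel_iff: "K \<le> unlabel L \<longleftrightarrow> (\<exists>S \<subseteq> verts L. unlabel (induced L S) = K)"
proof (induction K rule: ugraph.abs_induct)
  case (1 M)
  show ?case by (simp add: less_eq_ugraph.abs_eq ugraph.abs_eq_iff)
qed

lemma usize_unlabel_induced: "S \<subseteq> verts L \<Longrightarrow> usize (unlabel (induced L S)) = card S"
  by (simp add: usize.abs_eq inf.absorb2)

lemma le_unlabel_induced_iff:
  assumes "T \<subseteq> verts L"
  shows "K \<le> unlabel (induced L T) \<longleftrightarrow> (\<exists>S \<subseteq> T. unlabel (induced L S) = K)"
proof -
  have "verts (induced L T) = T" using assms by auto
  moreover have "induced (induced L T) S = induced L S" if "S \<subseteq> T" for S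
    using that by (simp add: inf.absorb2)
  ultimately show ?thesis unfolding le_unlabel_iff by metis
qed

lemma unlabel_induced_mono:
  "S \<subseteq> T \<Longrightarrow> T \<subseteq> verts L \<Longrightarrow> unlabel (induced L S) \<le> unlabel (induced L T)"
  by (auto simp: le_unlabel_induced_iff)

text \<open>Ties the order interval to vertex sets of one fixed labelling. In one direction
  transitivity places a copy of \<open>H\<close> inside the chosen copy \<open>S\<close> of
  \<open>K\<close>; in the other, vertex counts show that strict inclusions of sets give distinct
  isomorphism classes.\<close>

lemma interval_interior_eq:
  "{H..unlabel L} - {H, unlabel L} =
     {unlabel (induced L S) |S \<eta>. \<eta> \<in> occurrences H L \<and> \<eta> \<subset> S \<and> S \<subset> verts L}"
    (is "?I = ?J")
proof (rule set_eqI, rule iffI)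
  fix K assume K: "K \<in> ?I"
  then obtain S where S: "S \<subseteq> verts L" "K = unlabel (induced L S)"
    by (auto simp: le_unlabel_iff)
  with K obtain \<eta> where \<eta>: "\<eta> \<subseteq> S" "unlabel (induced L \<eta>) = H"
    by (auto simp: le_unlabel_induced_iff)
  have "\<eta> \<noteq> S" "S \<noteq> verts L" using K S \<eta> by auto
  with S \<eta> show "K \<in> ?J" unfolding occurrences_def by blast
next
  fix K assume "K \<in> ?J"
  then obtain S \<eta> where K: "K = unlabel (induced L S)" and S: "\<eta> \<subset> S" "S \<subset> verts L"
    and \<eta>: "\<eta> \<subseteq> verts L" "unlabel (induced L \<eta>) = H"
    by (auto simp: occurrences_def)
  have "card \<eta> < card S" "card S < card (verts L)"
    using S by (auto intro!: psubset_card_mono intro: finite_subset[OF _ finite_verts])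
  moreover have "usize H = card \<eta>" "usize K = card S" "usize (unlabel L) = card (verts L)"
    using usize_unlabel_induced[of \<eta> L] usize_unlabel_induced[of S L] S \<eta> K
    by (simp_all add: usize.abs_eq psubset_imp_subset)
  ultimately have "K \<noteq> H" "K \<noteq> unlabel L" by auto
  moreover have "H \<le> K" "K \<le> unlabel L"
    using S \<eta> K unlabel_induced_mono[of \<eta> S L] unlabel_induced_mono[of S "verts L" L] by auto
  ultimately show "K \<in> ?I" by simp
qed

text \<open>A copy \<open>W\<close> of the one-vertex extension inside \<open>T\<close> has some
  \<open>\<eta>'\<close> below it with class \<open>H\<close>. Since \<open>W\<close> has exactly
  one vertex more than \<open>\<eta>'\<close>, it is again a one-vertex extension of an occurrence,
  which is the form that strongness speaks about.\<close>

lemma occurrence_copy_within: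
  assumes \<eta>: "\<eta> \<in> occurrences H L" and i: "i \<in> verts L - \<eta>"
    and T: "T \<subseteq> verts L" "unlabel (induced L (\<eta> \<union> {i})) \<le> unlabel (induced L T)"
  obtains \<eta>' j where "\<eta>' \<in> occurrences H L" "j \<in> verts L - \<eta>'" "\<eta>' \<subseteq> T"
    "induced L (\<eta> \<union> {i}) \<cong>\<^sub>G induced L (\<eta>' \<union> {j})"
proof -
  have \<eta>V: "\<eta> \<subseteq> verts L" "\<eta> \<union> {i} \<subseteq> verts L" and H: "unlabel (induced L \<eta>) = H"
    using \<eta> i by (auto simp: occurrences_def)
  obtain W where W: "W \<subseteq> T" "unlabel (induced L W) = unlabel (induced L (\<eta> \<union> {i}))"
    using T by (auto simp: le_unlabel_induced_iff)
  have WV: "W \<subseteq> verts L" using W T by blast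
  have "H \<le> unlabel (induced L W)"
    using unlabel_induced_mono[OF _ \<eta>V(2), of \<eta>] W H by auto
  then obtain \<eta>' where \<eta>': "\<eta>' \<subseteq> W" "unlabel (induced L \<eta>') = H"
    using le_unlabel_induced_iff[OF WV] by blast
  have fin: "finite \<eta>" "finite W" "finite \<eta>'"
    using \<eta>V WV \<eta>' by (meson finite_subset finite_verts)+
  have "card W = card (\<eta> \<union> {i})"
    using usize_unlabel_induced[OF WV] usize_unlabel_induced[OF \<eta>V(2)] W(2) by simp
  moreover have "card \<eta>' = card \<eta>"
    using usize_unlabel_induced[OF subset_trans[OF \<eta>'(1) WV]] usize_unlabel_induced[OF \<eta>V(1)]
      \<eta>'(2) H by simp
  ultimately have "card (W - \<eta>') = 1"
    using i \<eta>' fin by (simp add: card_Diff_subset)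
  then obtain j where "W - \<eta>' = {j}" by (auto simp: card_1_singleton_iff)
  then have j: "W = \<eta>' \<union> {j}" "j \<notin> \<eta>'" using \<eta>' by auto
  show thesis
  proof (rule that)
    show "\<eta>' \<in> occurrences H L" using \<eta>' WV by (auto simp: occurrences_def)
    show "j \<in> verts L - \<eta>'" "\<eta>' \<subseteq> T" using j WV W by auto
    show "induced L (\<eta> \<union> {i}) \<cong>\<^sub>G induced L (\<eta>' \<union> {j})"
      using W(2) unfolding j(1) by (simp add: ugraph.abs_eq_iff isomorphic_sym)
  qed
qed

text \<open>Only one direction of comparability is treated: the assumptions on \<open>A\<close> and
  \<open>B\<close> are symmetric, so exchanging them gives the other.\<close>

lemma strongly_zero_split_sides_incomparable:
  assumes zsp: "zero_split_partition H L A B"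
    and strong: "\<And>\<eta> \<phi> i j. \<lbrakk>\<eta> \<in> A; \<phi> \<in> B; i \<in> verts L - \<eta>; j \<in> verts L - \<phi>\<rbrakk>
      \<Longrightarrow> \<not> induced L (\<eta> \<union> {i}) \<cong>\<^sub>G induced L (\<phi> \<union> {j})"
    and S: "\<eta> \<in> A" "\<eta> \<subset> S" "S \<subset> verts L" and T: "\<phi> \<in> B" "\<phi> \<subset> T" "T \<subset> verts L"
  shows "\<not> unlabel (induced L S) \<le> unlabel (induced L T)"
proof
  assume le: "unlabel (induced L S) \<le> unlabel (induced L T)"
  have occ: "A \<union> B = occurrences H L"
    and disj: "\<And>\<eta> \<phi>. \<eta> \<in> A \<Longrightarrow> \<phi> \<in> B \<Longrightarrow> zeros L \<eta> \<inter> zeros L \<phi> = {}"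
    using zsp by (auto simp: zero_split_partition_def)
  \<comment> \<open>Shrinking \<open>S\<close> to a single vertex beyond \<open>\<eta>\<close> keeps
    the graph below \<open>G[T]\<close> and reaches the one-vertex extensions.\<close>
  obtain i where i: "i \<in> S" "i \<notin> \<eta>" using S by blast
  have "unlabel (induced L (\<eta> \<union> {i})) \<le> unlabel (induced L T)"
    using S i le by (intro order_trans[OF unlabel_induced_mono le]) auto
  moreover have "\<eta> \<in> occurrences H L" "i \<in> verts L - \<eta>" "T \<subseteq> verts L"
    using S T i occ by auto
  ultimately obtain \<eta>' j where \<eta>': "\<eta>' \<in> occurrences H L" "j \<in> verts L - \<eta>'" "\<eta>' \<subseteq> T"
    "induced L (\<eta> \<union> {i}) \<cong>\<^sub>G induced L (\<eta>' \<union> {j})"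
    using occurrence_copy_within by metis
  have "\<eta>' \<in> A" using strong[of \<eta> \<eta>' i j] \<eta>' S i occ by blast
  moreover obtain v where "v \<in> verts L" "v \<notin> T" using T by blast
  ultimately show False using disj[of \<eta>' \<phi>] T \<eta>' by (auto simp: zeros_def)
qed

lemma zero_split_partition_sym: "zero_split_partition H L A B \<Longrightarrow> zero_split_partition H L B A"
  by (auto simp: zero_split_partition_def)

lemma strongly_zero_split_imp_disconnected:
  assumes split: "strongly_zero_split H L"
    and size: "\<And>\<eta>. \<eta> \<in> occurrences H L \<Longrightarrow> card (verts L - \<eta>) > 1"
  shows "disconnected_interval H (unlabel L)"
proof -
  obtain A B where zsp: "zero_split_partition H L A B"
    and strong: "\<And>\<eta> \<phi> i j. \<lbrakk>\<eta> \<in> A; \<phi> \<in> B; i \<in> verts L - \<eta>; j \<in> verts L - \<phi>\<rbrakk>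
      \<Longrightarrow> \<not> induced L (\<eta> \<union> {i}) \<cong>\<^sub>G induced L (\<phi> \<union> {j})"
    using split unfolding strongly_zero_split_def by blast
  have strong': "\<lbrakk>\<eta> \<in> B; \<phi> \<in> A; i \<in> verts L - \<eta>; j \<in> verts L - \<phi>\<rbrakk>
      \<Longrightarrow> \<not> induced L (\<eta> \<union> {i}) \<cong>\<^sub>G induced L (\<phi> \<union> {j})" for \<eta> \<phi> i j
    using strong isomorphic_sym by blast
  have occ: "A \<union> B = occurrences H L" "A \<noteq> {}" "B \<noteq> {}"
    using zsp by (auto simp: zero_split_partition_def)
  \<comment> \<open>The interior is split according to which class of occurrences lies below an
    element. That no element is on both sides follows from incomparability, by reflexivity of the
    order.\<close>
  define side where
    "side C = {unlabel (induced L S) |S \<eta>. \<eta> \<in> C \<and> \<eta> \<subset> S \<and> S \<subset> verts L}" for C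
  \<comment> \<open>This is where \<open>size\<close> enters: with two vertices missing from
    \<open>\<eta>\<close>, adding one of them still stays strictly below the whole graph.\<close>
  have nonempty: "side C \<noteq> {}" if "C \<noteq> {}" "C \<subseteq> occurrences H L" for C
  proof -
    obtain \<eta> where \<eta>: "\<eta> \<in> C" using \<open>C \<noteq> {}\<close> by blast
    then have "\<eta> \<subseteq> verts L" and gt: "card (verts L - \<eta>) > 1"
      using that size by (auto simp: occurrences_def)
    have "verts L - \<eta> \<noteq> {}"
    proof
      assume "verts L - \<eta> = {}"
      with gt show False by simp
    qed
    then obtain i where i: "i \<in> verts L - \<eta>" by blast
    have "insert i \<eta> \<noteq> verts L"
    proof
      assume "insert i \<eta> = verts L"
      with i have "verts L - \<eta> = {i}" by blast
      with gt show False by simp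
    qed
    with i \<open>\<eta> \<subseteq> verts L\<close> have "\<eta> \<subset> insert i \<eta>" "insert i \<eta> \<subset> verts L" by auto
    with \<eta> show ?thesis unfolding side_def by blast
  qed
  have incomparable: "\<not> a \<le> b \<and> \<not> b \<le> a" if "a \<in> side A" "b \<in> side B" for a b
    using that strongly_zero_split_sides_incomparable[OF zsp strong]
      strongly_zero_split_sides_incomparable[OF zero_split_partition_sym[OF zsp] strong']
    unfolding side_def by blast
  show ?thesis unfolding disconnected_interval_def
  proof (intro exI conjI)
    show "side A \<noteq> {}" "side B \<noteq> {}" using nonempty occ by blast+
    show "side A \<inter> side B = {}" using incomparable by blast
    show "side A \<union> side B = {H..unlabel L} - {H, unlabel L}"
      unfolding interval_interior_eq side_def occ(1)[symmetric] by blast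
    show "\<forall>a \<in> side A. \<forall>b \<in> side B. \<not> a \<le> b \<and> \<not> b \<le> a" using incomparable by blast
  qed
qed

lemma disconnected_imp_strongly_zero_split:
  assumes disc: "disconnected_interval H (unlabel L)"
    and size: "\<And>\<eta>. \<eta> \<in> occurrences H L \<Longrightarrow> card (verts L - \<eta>) > 2"
  shows "strongly_zero_split H L"
proof -
  let ?c = "\<lambda>S. unlabel (induced L S)" and ?V = "verts L"
  obtain P Q where PQ: "P \<noteq> {}" "Q \<noteq> {}" "P \<inter> Q = {}"
    and cover: "P \<union> Q = {?c S |S \<eta>. \<eta> \<in> occurrences H L \<and> \<eta> \<subset> S \<and> S \<subset> ?V}"
    and incomparable: "\<And>a b. a \<in> P \<Longrightarrow> b \<in> Q \<Longrightarrow> \<not> a \<le> b \<and> \<not> b \<le> a"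
    using disc unfolding disconnected_interval_def interval_interior_eq by metis
  have inPQ: "?c S \<in> P \<union> Q" if "\<eta> \<in> occurrences H L" "\<eta> \<subset> S" "S \<subset> ?V" for \<eta> S
    using that cover by blast
  have comparable: "?c S \<in> P \<longleftrightarrow> ?c T \<in> P"
    if "\<eta> \<in> occurrences H L" "\<eta> \<subset> S" "S \<subseteq> T" "T \<subset> ?V" for \<eta> S T
    using that inPQ[of \<eta> S] inPQ[of \<eta> T] unlabel_induced_mono[of S T L] incomparable by blast
  \<comment> \<open>The case \<open>i = j\<close> is included on purpose; it is used below for
    one-vertex extensions.\<close>
  have two_more: "\<eta> \<subset> \<eta> \<union> {i, j} \<and> \<eta> \<union> {i, j} \<subset> ?V"
    if "\<eta> \<in> occurrences H L" "i \<in> ?V - \<eta>" "j \<in> ?V - \<eta>" for \<eta> i j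
  proof -
    have "card {i, j} < card (?V - \<eta>)"
      using size[OF that(1)] card_insert_le_m1[of 2 "{j}" i] by (simp add: card_insert_if)
    then have "{i, j} \<noteq> ?V - \<eta>" by auto
    then show ?thesis using that by (auto simp: occurrences_def)
  qed
  have same_side: "?c S \<in> P \<longleftrightarrow> ?c T \<in> P"
    if "\<eta> \<in> occurrences H L" "\<eta> \<subset> S" "S \<subset> ?V" "\<eta> \<subset> T" "T \<subset> ?V" for \<eta> S T
  proof -
    from that obtain i j where ij: "i \<in> S - \<eta>" "j \<in> T - \<eta>" by blast
    have "\<eta> \<union> {i, j} \<subset> ?V" using two_more[of \<eta> i j] ij that by blast
    then show ?thesis
      using comparable[of \<eta> "\<eta> \<union> {i}" S] comparable[of \<eta> "\<eta> \<union> {i}" "\<eta> \<union> {i, j}"]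
        comparable[of \<eta> "\<eta> \<union> {j}" T] comparable[of \<eta> "\<eta> \<union> {j}" "\<eta> \<union> {i, j}"] ij that
      by blast
  qed
  \<comment> \<open>By \<open>same_side\<close>, one \<open>S\<close> above \<open>\<eta>\<close>
    with class in \<open>P\<close> forces all of them into \<open>P\<close>; hence the occurrences
    in the complement \<open>B\<close> have only elements of \<open>Q\<close> above them.\<close>
  define A where "A = {\<eta> \<in> occurrences H L. \<exists>S. \<eta> \<subset> S \<and> S \<subset> ?V \<and> ?c S \<in> P}"
  define B where "B = occurrences H L - A"
  have inA: "?c S \<in> P" if "\<eta> \<in> A" "\<eta> \<subset> S" "S \<subset> ?V" for \<eta> S
    using that same_side unfolding A_def by blast
  have inB: "?c S \<in> Q" if "\<eta> \<in> B" "\<eta> \<subset> S" "S \<subset> ?V" for \<eta> S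
    using that inPQ unfolding A_def B_def by blast
  \<comment> \<open>Some vertex other than \<open>v\<close> is also missing from
    \<open>\<eta>\<close>, so the inclusion is strict.\<close>
  have minus_vertex: "\<eta> \<subset> ?V - {v}" if "\<eta> \<in> occurrences H L" "v \<in> ?V - \<eta>" for \<eta> v
    using two_more[OF that that(2)] that(2) by blast
  have nonempty: "\<exists>S \<eta>. ?c S \<in> R \<and> \<eta> \<in> occurrences H L \<and> \<eta> \<subset> S \<and> S \<subset> ?V"
    if R: "R \<noteq> {}" "R \<subseteq> P \<union> Q" for R
  proof -
    from R(1) obtain r where r: "r \<in> R" by blast
    with R(2) have "r \<in> P \<union> Q" by (rule subsetD)
    with r show ?thesis unfolding cover by auto
  qed
  obtain S \<eta> where "?c S \<in> P" "\<eta> \<in> occurrences H L" "\<eta> \<subset> S" "S \<subset> ?V"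
    using nonempty[OF PQ(1)] by auto
  then have "\<eta> \<in> A" unfolding A_def by blast
  then have "A \<noteq> {}" by blast
  moreover have "B \<noteq> {}"
  proof -
    obtain S \<eta> where "?c S \<in> Q" "\<eta> \<in> occurrences H L" "\<eta> \<subset> S" "S \<subset> ?V"
      using nonempty[OF PQ(2)] by auto
    then have "\<eta> \<in> B" using inA PQ(3) unfolding B_def by blast
    then show ?thesis by blast
  qed
  moreover have "(\<Union>\<eta> \<in> A. zeros L \<eta>) \<inter> (\<Union>\<phi> \<in> B. zeros L \<phi>) = {}"
  proof (rule ccontr)
    assume "\<not> ?thesis"
    then obtain v \<eta> \<phi> where v: "\<eta> \<in> A" "\<phi> \<in> B" "v \<in> ?V - \<eta>" "v \<in> ?V - \<phi>"
      by (auto simp: zeros_def)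
    then have "\<eta> \<subset> ?V - {v}" "\<phi> \<subset> ?V - {v}"
      by (simp_all add: minus_vertex A_def B_def)
    moreover have "?V - {v} \<subset> ?V" using v(3) by blast
    ultimately have "?c (?V - {v}) \<in> P \<inter> Q" using inA[OF v(1)] inB[OF v(2)] by simp
    then show False using PQ(3) by simp
  qed
  moreover have "A \<inter> B = {}" "A \<union> B = occurrences H L" by (auto simp: A_def B_def)
  ultimately have "zero_split_partition H L A B"
    unfolding zero_split_partition_def by (intro conjI)
  \<comment> \<open>Isomorphic one-vertex extensions would be a single element of the interior,
    lying in both \<open>P\<close> and \<open>Q\<close>.\<close>
  moreover have "\<not> induced L (\<eta> \<union> {i}) \<cong>\<^sub>G induced L (\<phi> \<union> {j})"
    if "\<eta> \<in> A" "\<phi> \<in> B" "i \<in> ?V - \<eta>" "j \<in> ?V - \<phi>" for \<eta> \<phi> i j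
  proof -
    have "?c (\<eta> \<union> {i}) \<in> P"
      using inA[of \<eta> "\<eta> \<union> {i}"] two_more[of \<eta> i i] that unfolding A_def by auto
    moreover have "?c (\<phi> \<union> {j}) \<in> Q"
      using inB[of \<phi> "\<phi> \<union> {j}"] two_more[of \<phi> j j] that unfolding B_def by auto
    ultimately show ?thesis using PQ(3) by (metis IntI empty_iff ugraph.abs_eq_iff)
  qed
  ultimately show ?thesis unfolding strongly_zero_split_def by blast
qed

theorem theorem2p3:
  fixes H G :: ugraph and L :: graph
  assumes "labelling L G"
    and "H \<le> G"
    and "int (usize G) - int (usize H) > 2"
  shows "disconnected_interval H G \<longleftrightarrow> strongly_zero_split H L"
proof -
  have G: "G = unlabel L" using assms(1) by (simp add: labelling_def)
  \<comment> \<open>All occurrences have as many vertices as \<open>H\<close>, so the gap between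
    the sizes is the number of zeros of each.\<close>
  have "card (verts L - \<eta>) > 2" if "\<eta> \<in> occurrences H L" for \<eta>
  proof -
    have \<eta>: "\<eta> \<subseteq> verts L" and "usize H = card \<eta>"
      using that usize_unlabel_induced[of \<eta> L] by (auto simp: occurrences_def)
    then show ?thesis
      using assms(3) card_Diff_subset[OF finite_subset[OF \<eta> finite_verts] \<eta>]
      by (simp add: G usize.abs_eq)
  qed
  then show ?thesis
    using strongly_zero_split_imp_disconnected[of H L] disconnected_imp_strongly_zero_split[of H L]
    unfolding G by force
qed

end
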